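(* Let $n\ge 2$ and $1\le m\le|\mathbf{C}(n)|$. Let $\alpha_1,\alpha_2,\ldots,\alpha_m$ be the last $m$ strings of $\mathbf{C}(n)$ when it is listed in lexicographic order. Then $\text{UC}(\alpha_1,\ldots,\alpha_m)=pr(\alpha_1)pr(\alpha_2)\cdots pr(\alpha_m)$ is a universal cycle for $\mathbf{S}=\bigcup_{i=1}^m\mathbf{sub}_n(\alpha_i)$.
   Context: Strings are binary, over $\{0,1\}$; $\Sigma_2^n$ is the set of binary strings of length $n$. For a binary string $\alpha$, $\overline{\alpha}$ is its bitwise complement. A necklace is a string that is lexicographically smallest among all its rotations. A binary string $\gamma$ of length $n$ is a co-necklace if $\gamma\overline{\gamma}$ is a necklace; $\mathbf{coN}(n)=\{\gamma\overline{\gamma}:\gamma\text{ a co-necklace of length } n\}$. $\mathbf{C}(n)$ is the set of all binary $\alpha=a_1\cdots a_{2n}$ such that $a_{i+1}\cdots a_{2n}a_1\cdots a_i\in\mathbf{coN}(n)$, where $i$ is the largest index with $a_i\ne 0$ (e.g. $\mathbf{C}(5)=\{1111100000,1011101000,1001101100,1010101010\}$). Lexicographic order on strings of equal length: $a_1\cdots a_\ell$ precedes $b_1\cdots b_\ell$ if $a_i<b_i$ at the smallest $i$ with $a_i\ne b_i$. The periodic reduction $pr(a_1\cdots a_\ell)$ is $a_1\cdots a_p$ where $p$ is the smallest integer with $a_1\cdots a_\ell=(a_1\cdots a_p)^{\ell/p}$. For a string $\alpha$, $\mathbf{sub}_n(\alpha)$ is the set of all length-$n$ substrings of $\alpha$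 viewed as a cyclic string (windows may wrap around). For a nonempty $\mathbf{S}\subseteq\Sigma_2^n$, a universal cycle for $\mathbf{S}$ is a string of length $|\mathbf{S}|$ which, viewed cyclically, contains every string of $\mathbf{S}$ as a length-$n$ substring exactly once.
   Formalization: C(n) is taken to contain only strings beginning with 1, as in the displayed C(5); the literal definition also admits strings such as 0110 for n = 2, for which the claim fails (m = 2). *)

theory Defs
  imports Main "HOL-Library.List_Lexorder"
begin

text \<open>Binary strings are values of type \<^typ>\<open>bool list\<close>, with \<^const>\<open>False\<close> for 0 and \<^const>\<open>True\<close>
  for 1; \<open>\<le>\<close> on lists is the lexicographic order.\<close>

definition \<Sigma>2 :: "nat \<Rightarrow> bool list set" where
  "\<Sigma>2 n = {w. length w = n}"

definition complement :: "bool list \<Rightarrow> bool list" where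
  "complement w = map Not w"

definition necklace :: "bool list \<Rightarrow> bool" where
  "necklace w \<longleftrightarrow> (\<forall>k. w \<le> rotate k w)"

definition co_necklace :: "bool list \<Rightarrow> bool" where
  "co_necklace g \<longleftrightarrow> necklace (g @ complement g)"

definition coN :: "nat \<Rightarrow> bool list set" where
  "coN n = {g @ complement g | g. g \<in> \<Sigma>2 n \<and> co_necklace g}"

text \<open>The position is counted from 1, so that \<open>rotate (last_one_index w) w\<close> is
  \<open>a\<^sub>i\<^sub>+\<^sub>1 \<dots> a\<^sub>\<ell> a\<^sub>1 \<dots> a\<^sub>i\<close>, where \<open>i\<close> is the largest index with \<open>a\<^sub>i \<noteq> 0\<close>.\<close>

definition last_one_index :: "bool list \<Rightarrow> nat" where
  "last_one_index w = (GREATEST i. 1 \<le> i \<and> i \<le> length w \<and> w ! (i - 1))"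

text \<open>The condition that a string starts with 1 selects exactly one rotation for each element
  of \<open>coN n\<close>, the one in which the whole initial block of 0s has been moved to the end. Without it,
  moving any part of that block would be allowed: both \<open>0000011111\<close> and \<open>0011111000\<close> would
  belong to \<open>C 5\<close> besides \<open>1111100000\<close>.\<close>

definition C :: "nat \<Rightarrow> bool list set" where
  "C n = {w \<in> \<Sigma>2 (2 * n). w \<noteq> [] \<and> hd w \<and> rotate (last_one_index w) w \<in> coN n}"

definition pr :: "bool list \<Rightarrow> bool list" where
  "pr w = take (LEAST p. 1 \<le> p \<and> p dvd length w \<and>
                         w = concat (replicate (length w div p) (take p w))) w"

definition cyclic_window :: "nat \<Rightarrow> bool list \<Rightarrow> nat \<Rightarrow> bool list" where
  "cyclic_window n w i = map (\<lambda>j. w ! ((i + j) mod length w)) [0..<n]"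

definition sub :: "nat \<Rightarrow> bool list \<Rightarrow> bool list set" where
  "sub n w = {cyclic_window n w i | i. i < length w}"

definition universal_cycle :: "nat \<Rightarrow> bool list set \<Rightarrow> bool list \<Rightarrow> bool" where
  "universal_cycle n S u \<longleftrightarrow>
     S \<noteq> {} \<and> S \<subseteq> \<Sigma>2 n \<and> length u = card S \<and>
     (\<forall>s\<in>S. \<exists>!i. i < length u \<and> cyclic_window n u i = s)"

definition UC :: "bool list list \<Rightarrow> bool list" where
  "UC ws = concat (map pr ws)"

end

theory Submission imports Defs begin

text \<open>The strings of \<open>C n\<close> represent the cycles of the complementing cycling register
  \<open>a\<^sub>1 \<dots> a\<^sub>n \<mapsto> a\<^sub>2 \<dots> a\<^sub>n \<not>a\<^sub>1\<close>, so their window sets are disjoint and \<open>sub n \<alpha>\<close> has as many elements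
  as \<open>pr \<alpha>\<close> has letters. It therefore suffices to find every window somewhere in the concatenation.

  If \<open>\<alpha>\<close> ends in exactly \<open>k < n\<close> zeros, then replacing its \<open>(n-k)\<close>-th letter by 1 (and the antipodal
  letter by 0) gives a larger string of \<open>C n\<close>; hence the lexicographic successor of \<open>\<alpha>\<close> agrees with
  \<open>\<alpha>\<close> on the first \<open>n-k-1\<close> letters. So \<open>pr \<alpha>\<close> followed by the rest of the concatenation contains all
  windows of \<open>\<alpha>\<close> that start before the trailing zeros. The other windows have the form \<open>0\<^sup>r \<rho>\<close>, where
  \<open>\<rho>\<close> is a prefix of \<open>\<alpha>\<close>; they appear at the junction in front of the first listed string with
  prefix \<open>\<rho>\<close>.\<close>

section \<open>Cyclic indexing and lexicographic comparison\<close>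

text \<open>Reducing the index modulo the length turns rotations into shifts of the argument and
  lets windows wrap around.\<close>

definition cyc :: "'a list \<Rightarrow> nat \<Rightarrow> 'a" where
  "cyc w i = w ! (i mod length w)"

lemma cyc_nth: "i < length w \<Longrightarrow> cyc w i = w ! i"
  by (simp add: cyc_def)

lemma cyc_add_length [simp]: "cyc w (i + length w) = cyc w i"
  by (simp add: cyc_def)

lemma periodic_add_mult:
  assumes "\<And>i. f (i + p) = f i"
  shows "f (i + c * p) = f (i :: nat)"
proof (induction c)
  case (Suc c)
  have "f (i + Suc c * p) = f ((i + c * p) + p)" by (simp add: algebra_simps)
  then show ?case using assms Suc by metis
qed simp

lemma periodic_mod:
  assumes "\<And>i. f (i + p) = f i"
  shows "f (i mod p) = f (i :: nat)"
  using periodic_add_mult[of f p "i mod p" "i div p", OF assms]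
  by (simp add: add.commute)

lemma cyc_rotate: "w \<noteq> [] \<Longrightarrow> cyc (rotate k w) i = cyc w (k + i)"
  by (simp add: cyc_def nth_rotate mod_add_right_eq)

lemma cyc_eqI:
  assumes "length v = length w" "\<And>i. cyc v i = cyc w i"
  shows "v = w"
  by (rule nth_equalityI) (use assms cyc_nth in metis)+

lemma cyclic_window_cyc: "cyclic_window n w i = map (\<lambda>j. cyc w (i + j)) [0..<n]"
  by (simp add: cyclic_window_def cyc_def)

lemma cyclic_window_eq_iff:
  "cyclic_window n v s = cyclic_window n w t \<longleftrightarrow> (\<forall>j<n. cyc v (s + j) = cyc w (t + j))"
  by (auto simp: cyclic_window_cyc)

lemma list_less_nthI:
  fixes xs ys :: "'a::linorder list"
  assumes "length xs = length ys" "j < length xs" "\<And>i. i < j \<Longrightarrow> xs ! i = ys ! i" "xs ! j < ys ! j"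
  shows "xs < ys"
  using assms
proof (induction xs ys arbitrary: j rule: list_induct2)
  case (Cons x xs y ys)
  show ?case
  proof (cases j)
    case 0
    then show ?thesis using Cons.prems by simp
  next
    case (Suc i)
    have "xs < ys"
      by (rule Cons.IH[of i]) (use Cons.prems(1,3) Cons.prems(2)[of "Suc _"] Suc in auto)
    moreover have "x = y" using Cons.prems(2)[of 0] Suc by simp
    ultimately show ?thesis by simp
  qed
qed simp

lemma list_less_nthE:
  fixes xs ys :: "'a::linorder list"
  assumes "length xs = length ys" "xs < ys"
  obtains j where "j < length xs" "\<And>i. i < j \<Longrightarrow> xs ! i = ys ! i" "xs ! j < ys ! j"
proof -
  have "\<exists>j<length xs. xs ! j \<noteq> ys ! j"
    using assms nth_equalityI[of xs ys] by auto
  then obtain j where j: "j < length xs" "xs ! j \<noteq> ys ! j"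
    and min: "\<And>i. i < j \<Longrightarrow> xs ! i = ys ! i"
    using exists_least_iff[of "\<lambda>j. j < length xs \<and> xs ! j \<noteq> ys ! j"] by (metis less_trans)
  moreover have "\<not> ys ! j < xs ! j"
    using list_less_nthI[of ys xs j] assms j min by auto
  ultimately show ?thesis using that by force
qed

text \<open>If \<open>ys\<close> first leaves \<open>xs\<close> within the first \<open>l\<close>
  letters, it goes up there and so exceeds \<open>zs\<close> too.\<close>

lemma list_squeeze_nth:
  fixes xs ys zs :: "'a::linorder list"
  assumes len: "length xs = length ys" "length zs = length ys" and le: "xs \<le> ys" "ys \<le> zs"
    and eq: "\<And>i. i < l \<Longrightarrow> xs ! i = zs ! i" and "i < l" "l \<le> length xs"
  shows "ys ! i = xs ! i"
proof (rule ccontr)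
  assume "ys ! i \<noteq> xs ! i"
  then have "xs < ys" using le by (metis order_le_less)
  then obtain j where j: "j < length xs" "\<And>i. i < j \<Longrightarrow> xs ! i = ys ! i" "xs ! j < ys ! j"
    using list_less_nthE len by metis
  have "j \<le> i" using j(2)[of i] \<open>ys ! i \<noteq> xs ! i\<close> by force
  then have "j < l" using \<open>i < l\<close> by simp
  have "zs < ys"
    by (rule list_less_nthI[of _ _ j]) (use j len eq \<open>j < l\<close> in auto)
  then show False using le by simp
qed

subsection \<open>Minimal periods\<close>

definition period :: "bool list \<Rightarrow> nat" where
  "period w = (LEAST p. 1 \<le> p \<and> p dvd length w \<and>
                        w = concat (replicate (length w div p) (take p w)))"

lemma pr_eq_take: "pr w = take (period w) w"
  by (simp add: pr_def period_def)

lemma nth_concat_replicate: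
  "i < c * length xs \<Longrightarrow> concat (replicate c xs) ! i = xs ! (i mod length xs)"
proof (induction c arbitrary: i)
  case (Suc c)
  then show ?case
    by (cases "i < length xs") (auto simp: nth_append le_mod_geq)
qed simp

text \<open>Replaces powers of a prefix by shift invariance of \<open>cyc\<close>, the form in which
  periods are used from here on.\<close>

lemma concat_replicate_take_iff:
  assumes "w \<noteq> []" "0 < p" "p dvd length w"
  shows "w = concat (replicate (length w div p) (take p w)) \<longleftrightarrow> (\<forall>i. cyc w (i + p) = cyc w i)"
    (is "w = ?c \<longleftrightarrow> _")
proof -
  have "p \<le> length w" using assms by (simp add: dvd_imp_le)
  then have len: "length ?c = length w"
    using assms by (simp add: length_concat sum_list_replicate)
  have c: "?c ! i = w ! (i mod p)" if "i < length w" for i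
    using nth_concat_replicate[of i "length w div p" "take p w"] that assms \<open>p \<le> length w\<close>
    by simp
  show ?thesis
  proof
    assume "w = ?c"
    then have "cyc w i = w ! (i mod p)" for i
      using c[of "i mod length w"] assms by (simp add: cyc_def mod_mod_cancel)
    then show "\<forall>i. cyc w (i + p) = cyc w i" by simp
  next
    assume per: "\<forall>i. cyc w (i + p) = cyc w i"
    show "w = ?c"
    proof (rule nth_equalityI)
      fix i assume i: "i < length w"
      have "i mod p < length w" using \<open>p \<le> length w\<close> assms
        by (meson less_le_trans mod_less_divisor)
      then show "w ! i = ?c ! i"
        using c[OF i] periodic_mod[of "cyc w" p i] per i by (simp add: cyc_nth)
    qed (simp add: len)
  qed
qed

lemma period:
  assumes "w \<noteq> []"
  shows period_pos: "0 < period w" and period_dvd: "period w dvd length w"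
    and cyc_add_period: "cyc w (i + period w) = cyc w i"
proof -
  have "1 \<le> period w \<and> period w dvd length w \<and>
      w = concat (replicate (length w div period w) (take (period w) w))"
    unfolding period_def by (rule LeastI[of _ "length w"]) (use assms in \<open>simp add: Suc_leI\<close>)
  moreover from this show "0 < period w" "period w dvd length w" by auto
  ultimately show "cyc w (i + period w) = cyc w i"
    using concat_replicate_take_iff assms by blast
qed

lemma period_le_length: "w \<noteq> [] \<Longrightarrow> period w \<le> length w"
  by (simp add: dvd_imp_le period_dvd)

lemma length_pr: "w \<noteq> [] \<Longrightarrow> length (pr w) = period w"
  by (simp add: pr_eq_take period_le_length)

text \<open>\<open>period\<close> minimises over divisors of the length only. By Bezout, an
  arbitrary shift period \<open>d\<close> yields the shift period \<open>gcd d (length w)\<close>,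
  which is such a divisor.\<close>

lemma period_least:
  assumes "w \<noteq> []" "0 < d" "\<And>i. cyc w (i + d) = cyc w i"
  shows "period w \<le> d"
proof -
  define g where "g = gcd d (length w)"
  have "0 < g" "g dvd length w" "g \<le> d" using assms by (auto simp: g_def)
  obtain x y where xy: "d * x = length w * y + g"
    using bezout_nat[of d "length w"] assms by (auto simp: g_def)
  have "cyc w (i + g) = cyc w i" for i
  proof -
    have "cyc w (i + g) = cyc w ((i + g) + y * length w)"
      by (rule periodic_add_mult[symmetric]) simp
    also have "(i + g) + y * length w = i + x * d"
      using xy by (simp add: algebra_simps)
    also have "cyc w \<dots> = cyc w i"
      by (rule periodic_add_mult) (rule assms)
    finally show ?thesis .
  qed
  then have "period w \<le> g"
    unfolding period_def using concat_replicate_take_iff[of w g] assms \<open>0 < g\<close> \<open>g dvd length w\<close>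
    by (intro Least_le) auto
  with \<open>g \<le> d\<close> show ?thesis by simp
qed

subsection \<open>The strings in \<open>C n\<close>\<close>

lemma last_one_index:
  assumes "w \<noteq> []" "hd w"
  shows "1 \<le> last_one_index w" "last_one_index w \<le> length w" "w ! (last_one_index w - 1)"
    and "\<And>j. last_one_index w \<le> j \<Longrightarrow> j < length w \<Longrightarrow> \<not> w ! j"
proof -
  let ?P = "\<lambda>i. 1 \<le> i \<and> i \<le> length w \<and> w ! (i - 1)"
  \<comment> \<open>The leading 1 is a candidate, so the \<open>GREATEST\<close> is
    attained.\<close>
  have "?P 1" using assms by (simp add: hd_conv_nth Suc_leI)
  then have "?P (last_one_index w)"
    unfolding last_one_index_def by (rule GreatestI_nat[of ?P 1 "length w"]) simp
  then show "1 \<le> last_one_index w" "last_one_index w \<le> length w" "w ! (last_one_index w - 1)"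
    by auto
  fix j assume j: "last_one_index w \<le> j" "j < length w"
  show "\<not> w ! j"
  proof
    assume "w ! j"
    then have "?P (Suc j)" using j by simp
    then have "Suc j \<le> last_one_index w"
      unfolding last_one_index_def by (rule Greatest_le_nat[of ?P _ "length w"]) simp
    then show False using j by simp
  qed
qed

text \<open>Antiperiodicity of \<open>cyc\<close> survives rotation, so it can be moved from the
  rotated string in the definition of \<open>C\<close> to the string itself.\<close>

lemma append_complement_iff:
  assumes "length w = 2 * n" "0 < n"
  shows "(\<exists>g. length g = n \<and> w = g @ complement g) \<longleftrightarrow> (\<forall>i. cyc w (i + n) = (\<not> cyc w i))"
proof
  assume "\<exists>g. length g = n \<and> w = g @ complement g"
  then obtain g where g: "length g = n" "w = g @ complement g" by blast
  show "\<forall>i. cyc w (i + n) = (\<not> cyc w i)"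
  proof
    fix i
    define x where "x = i mod (2 * n)"
    have "x < 2 * n" using assms by (simp add: x_def)
    have xn: "cyc w i = w ! x" "cyc w (i + n) = w ! ((x + n) mod (2 * n))"
      by (simp_all only: cyc_def assms x_def mod_add_left_eq)
    show "cyc w (i + n) = (\<not> cyc w i)"
    proof (cases "x < n")
      case True
      then show ?thesis unfolding xn using g by (simp add: nth_append complement_def)
    next
      case False
      then have "(x + n) mod (2 * n) = x - n"
        using \<open>x < 2 * n\<close> by (simp add: mod_if)
      then show ?thesis unfolding xn using g False \<open>x < 2 * n\<close>
        by (simp add: nth_append complement_def)
    qed
  qed
next
  assume anti: "\<forall>i. cyc w (i + n) = (\<not> cyc w i)"
  have "drop n w = complement (take n w)"
  proof (rule nth_equalityI)
    fix i assume "i < length (drop n w)"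
    then have "i < n" using assms by simp
    then show "drop n w ! i = complement (take n w) ! i"
      using anti[rule_format, of i] assms
      by (simp add: complement_def cyc_nth add.commute)
  qed (use assms in \<open>simp add: complement_def\<close>)
  then show "\<exists>g. length g = n \<and> w = g @ complement g"
    using assms by (intro exI[of _ "take n w"]) (metis append_take_drop_id length_take min_absorb2 mult_2 le_add1)
qed

lemma C_iff:
  assumes "0 < n"
  shows "w \<in> C n \<longleftrightarrow> length w = 2 * n \<and> hd w \<and> (\<forall>i. cyc w (i + n) = (\<not> cyc w i)) \<and>
           (\<forall>t. rotate (last_one_index w) w \<le> rotate t w)"
proof (cases "length w = 2 * n \<and> hd w")
  case True
  let ?L = "last_one_index w"
  have ne: "w \<noteq> []" using True assms by auto
  have L: "?L \<le> 2 * n" using last_one_index(2)[OF ne] True by simp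
  have "w \<in> C n \<longleftrightarrow> (\<exists>g. length g = n \<and> rotate ?L w = g @ complement g) \<and> necklace (rotate ?L w)"
    using True ne by (auto simp: C_def \<Sigma>2_def coN_def co_necklace_def)
  moreover have "(\<exists>g. length g = n \<and> rotate ?L w = g @ complement g) \<longleftrightarrow>
      (\<forall>i. cyc w (i + n) = (\<not> cyc w i))"
  proof -
    have "(\<exists>g. length g = n \<and> rotate ?L w = g @ complement g) \<longleftrightarrow>
      (\<forall>i. cyc w (?L + (i + n)) = (\<not> cyc w (?L + i)))"
      using append_complement_iff[of "rotate ?L w" n] True assms ne by (simp add: cyc_rotate)
    also have "\<dots> \<longleftrightarrow> (\<forall>i. cyc w (i + n) = (\<not> cyc w i))"
    proof
      assume *: "\<forall>i. cyc w (?L + (i + n)) = (\<not> cyc w (?L + i))"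
      show "\<forall>i. cyc w (i + n) = (\<not> cyc w i)"
      proof
        fix i
        have "?L + (i + (2 * n - ?L)) = i + length w" "?L + (i + (2 * n - ?L) + n) = i + n + length w"
          using L True by auto
        then show "cyc w (i + n) = (\<not> cyc w i)"
          using *[rule_format, of "i + (2 * n - ?L)"] by (metis cyc_add_length)
      qed
    qed (metis add.assoc)
    finally show ?thesis .
  qed
  moreover have "necklace (rotate ?L w) \<longleftrightarrow> (\<forall>t. rotate ?L w \<le> rotate t w)"
  proof -
    have "rotate t w = rotate (t + (2 * n - ?L)) (rotate ?L w)" for t
    proof -
      have "t + (2 * n - ?L) + ?L = t + length w" using L True by simp
      then show ?thesis
        by (simp only: rotate_rotate) (metis mod_add_self2 rotate_conv_mod)
    qed
    then show ?thesis unfolding necklace_def by (metis rotate_rotate)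
  qed
  ultimately show ?thesis using True by blast
qed (auto simp: C_def \<Sigma>2_def)

definition trailing_zeros :: "bool list \<Rightarrow> nat" where
  "trailing_zeros w = length w - last_one_index w"

text \<open>The necklace begins with the final zeros followed by the leading 1 of \<open>w\<close>,
  so no run of zeros on the cycle is longer. The ones ending the first half are antipodal to these
  zeros.\<close>

lemma trailing_zeros:
  assumes "w \<in> C n" "0 < n"
  shows "trailing_zeros w \<le> n" "0 < trailing_zeros w"
    and "\<And>j. 2 * n - trailing_zeros w \<le> j \<Longrightarrow> j < 2 * n \<Longrightarrow> \<not> w ! j"
    and "\<And>j. n - trailing_zeros w \<le> j \<Longrightarrow> j < n \<Longrightarrow> w ! j"
    and "trailing_zeros w < n \<Longrightarrow> \<not> w ! (n - trailing_zeros w - 1)"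
    and "\<exists>j\<le>trailing_zeros w. cyc w (t + j)"
    and "period w > trailing_zeros w"
proof -
  let ?L = "last_one_index w" and ?k = "trailing_zeros w"
  have len: "length w = 2 * n" and hd: "hd w" and anti: "\<And>i. cyc w (i + n) = (\<not> cyc w i)"
    and neck: "\<And>t. rotate ?L w \<le> rotate t w"
    using assms by (auto simp: C_iff)
  have ne: "w \<noteq> []" using len assms by auto
  have w0: "w ! 0" using hd ne by (simp add: hd_conv_nth)
  note L = last_one_index[OF ne hd]
  have k: "?L + ?k = 2 * n" using L(2) len by (simp add: trailing_zeros_def)
  have nth_anti: "w ! (i + n) = (\<not> w ! i)" if "i < n" for i
    using anti[of i] that len by (simp add: cyc_nth)
  have "w ! (n - 1) \<or> w ! (2 * n - 1)"
    using nth_anti[of "n - 1"] assms by (simp add: mult_2)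
  show zeros: "\<not> w ! j" if "2 * n - ?k \<le> j" "j < 2 * n" for j
  proof -
    have "?L \<le> j" using that k by linarith
    then show ?thesis using L(4) that len by simp
  qed
  \<comment> \<open>If the last letter were 1, \<open>w\<close> would itself be the necklace, yet
    its rotation by \<open>n\<close> starts with 0 and is smaller.\<close>
  have last0: "\<not> w ! (2 * n - 1)"
  proof
    assume last: "w ! (2 * n - 1)"
    moreover have "2 * n - 1 < length w" using len assms(2) by simp
    ultimately have "\<not> ?L \<le> 2 * n - 1" using L(4)[of "2 * n - 1"] by blast
    then have "?L = 2 * n" using k by linarith
    then have "rotate ?L w = w" using len by (metis rotate_id mod_self)
    have "rotate n w < w"
      by (rule list_less_nthI[of _ _ 0])
        (use len assms w0 nth_anti[of 0] in \<open>auto simp: nth_rotate\<close>)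
    then show False using neck[of n] \<open>rotate ?L w = w\<close> by simp
  qed
  show kpos: "0 < ?k"
  proof (rule ccontr)
    assume "\<not> 0 < ?k"
    then have "?L = 2 * n" using k by simp
    then show False using L(3) last0 by simp
  qed
  have "w ! (n - 1)" using \<open>w ! (n - 1) \<or> w ! (2 * n - 1)\<close> last0 by simp
  moreover have "n - 1 < length w" using len assms(2) by simp
  ultimately have "\<not> ?L \<le> n - 1" using L(4)[of "n - 1"] by blast
  then have "n \<le> ?L" by linarith
  then show kn: "?k \<le> n" using k by simp
  show "w ! j" if "n - ?k \<le> j" "j < n" for j
    using zeros[of "j + n"] nth_anti[of j] that kn by simp
  show "\<not> w ! (n - ?k - 1)" if "?k < n"
  proof -
    have "?L - 1 = (n - ?k - 1) + n" using that k kpos by simp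
    then show ?thesis using L(3) nth_anti[of "n - ?k - 1"] that by simp
  qed
  show "\<exists>j\<le>?k. cyc w (t + j)"
  proof (rule ccontr)
    assume *: "\<not> (\<exists>j\<le>?k. cyc w (t + j))"
    have one: "rotate ?L w ! ?k"
      using w0 len k kpos kn assms by (simp add: nth_rotate)
    have "rotate t w < rotate ?L w"
    proof (rule list_less_nthI[of _ _ ?k])
      show "?k < length (rotate t w)" using kn len assms by simp
      have rt: "\<not> rotate t w ! i" if "i \<le> ?k" for i
        using * that len kn assms by (simp add: nth_rotate cyc_def)
      then show "rotate t w ! ?k < rotate ?L w ! ?k" using one by simp
      fix i assume "i < ?k"
      then have "\<not> rotate ?L w ! i"
        using zeros[of "?L + i"] k len kn by (simp add: nth_rotate)
      then show "rotate t w ! i = rotate ?L w ! i" using rt[of i] \<open>i < ?k\<close> by simp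
    qed simp
    then show False using neck[of t] by simp
  qed
  \<comment> \<open>A period of at most \<open>?k\<close> would copy the leading 1 into the final
    zeros.\<close>
  show "period w > ?k"
  proof (rule ccontr)
    assume "\<not> period w > ?k"
    then have "\<not> w ! (2 * n - period w)"
      using zeros[of "2 * n - period w"] period_pos[OF ne] assms by simp
    moreover have "cyc w (2 * n - period w) = cyc w 0"
      using cyc_add_period[OF ne, of "2 * n - period w"] period_le_length[OF ne] len
        cyc_add_length[of w 0] by simp
    ultimately show False
      using w0 len period_pos[OF ne] assms by (simp add: cyc_nth)
  qed
qed

section \<open>Windows as states of the complementing register\<close>

text \<open>By antiperiodicity, \<open>n\<close> consecutive letters determine all later
  ones.\<close>

lemma cyclic_window_C_eq:
  assumes "0 < n" "v \<in> C n" "w \<in> C n" "cyclic_window n v s = cyclic_window n w t"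
  shows "cyc v (s + j) = cyc w (t + j)"
proof (induction j rule: less_induct)
  case (less j)
  show ?case
  proof (cases "j < n")
    case True
    then show ?thesis using assms by (simp add: cyclic_window_eq_iff)
  next
    case False
    have "cyc v (s + (j - n)) = cyc w (t + (j - n))"
      by (rule less.IH) (use False assms in simp)
    moreover have "cyc v (s + (j - n) + n) = (\<not> cyc v (s + (j - n)))"
      "cyc w (t + (j - n) + n) = (\<not> cyc w (t + (j - n)))"
      using assms by (auto simp: C_iff)
    ultimately show ?thesis using False by simp
  qed
qed

text \<open>The two strings share their least rotation. Both start with 1, so the number of leading
  zeros of that rotation recovers \<open>last_one_index\<close> and hence the string.\<close>

lemma C_rotation_unique:
  assumes n: "0 < n" and v: "v \<in> C n" and w: "w \<in> C n" and eq: "w = rotate s v"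
  shows "v = w"
proof -
  let ?L = last_one_index
  have ne: "v \<noteq> []" "w \<noteq> []" and len: "length v = 2 * n" "length w = 2 * n"
    and hd: "hd v" "hd w"
    using v w n by (auto simp: C_iff)
  have "v = rotate (2 * n - s mod (2 * n)) w"
  proof (rule cyc_eqI)
    fix i
    have "cyc (rotate (2 * n - s mod (2 * n)) w) i = cyc v (s mod (2 * n) + (2 * n - s mod (2 * n) + i))"
      using ne eq len by (metis cyc_rotate rotate_conv_mod)
    also have "s mod (2 * n) + (2 * n - s mod (2 * n) + i) = i + length v"
      using mod_less_divisor[of "2 * n" s] n len by linarith
    finally show "cyc v i = cyc (rotate (2 * n - s mod (2 * n)) w) i" by simp
  qed (use len in simp)
  then obtain s' where s': "v = rotate s' w" by blast
  have "rotate (?L v) v \<le> rotate (?L w + s) v" "rotate (?L w) w \<le> rotate (?L v + s') w"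
    using v w n by (auto simp: C_iff)
  then have "rotate (?L v) v = rotate (?L w) w"
    using eq s' by (metis rotate_rotate order_antisym)
  then have shift: "cyc v (?L v + i) = cyc w (?L w + i)" for i
    using cyc_rotate ne by metis
  \<comment> \<open>Where \<open>y\<close> wraps around to its leading 1, \<open>x\<close> would
    still be inside its final zeros.\<close>
  have no_less: False
    if "length x = 2 * n" "length y = 2 * n" "hd x" "hd y" "?L x < ?L y"
      and sh: "\<And>i. cyc x (?L x + i) = cyc y (?L y + i)" for x y
  proof -
    have ne: "x \<noteq> []" "y \<noteq> []" using that n by auto
    note L = last_one_index[OF ne(1) that(3)] last_one_index[OF ne(2) that(4)]
    have "cyc y (?L y + (2 * n - ?L y)) = y ! 0"
      using L that by (simp add: cyc_def)
    then have "cyc x (?L x + (2 * n - ?L y))"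
      using sh that ne by (simp add: hd_conv_nth)
    moreover have "?L x + (2 * n - ?L y) < 2 * n" "?L x \<le> ?L x + (2 * n - ?L y)"
      using L that by auto
    ultimately show False using L(4) that(1) by (metis cyc_nth)
  qed
  have "?L v = ?L w"
    using no_less[of v w] no_less[of w v] shift len hd by (metis linorder_neqE_nat)
  show ?thesis
  proof (rule cyc_eqI)
    fix i
    have "?L v \<le> 2 * n" using last_one_index(2)[OF ne(1) hd(1)] len by simp
    then have "?L v + (2 * n - ?L v + i) = i + 2 * n" by simp
    then show "cyc v i = cyc w i"
      using shift[of "2 * n - ?L v + i"] len \<open>?L v = ?L w\<close> by (metis cyc_add_length)
  qed (use len in simp)
qed

lemma sub_disjoint:
  assumes n: "0 < n" and v: "v \<in> C n" and w: "w \<in> C n" and "v \<noteq> w"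
  shows "sub n v \<inter> sub n w = {}"
proof (rule ccontr)
  assume "sub n v \<inter> sub n w \<noteq> {}"
  then obtain s t where "cyclic_window n v s = cyclic_window n w t"
    by (auto simp: sub_def)
  then have eq: "cyc v (s + j) = cyc w (t + j)" for j
    using cyclic_window_C_eq assms by blast
  have ne: "v \<noteq> []" and len: "length v = 2 * n" "length w = 2 * n"
    using v w n by (auto simp: C_iff)
  \<comment> \<open>In the natural numbers, \<open>(2 * n - 1) * t\<close> stands for
    \<open>- t\<close> modulo \<open>2 * n\<close>.\<close>
  have "w = rotate (s + (2 * n - 1) * t) v"
  proof (rule cyc_eqI)
    fix i
    have "cyc w i = cyc w (i + t * length w)"
      by (rule periodic_add_mult[symmetric]) simp
    also have "i + t * length w = t + ((2 * n - 1) * t + i)"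
      using len n by (cases n) (simp_all add: algebra_simps)
    also have "cyc w \<dots> = cyc v (s + ((2 * n - 1) * t + i))" using eq by simp
    finally show "cyc w i = cyc (rotate (s + (2 * n - 1) * t) v) i"
      using ne by (simp add: cyc_rotate add.assoc)
  qed (use len in simp)
  then show False using C_rotation_unique assms by blast
qed

lemma finite_sub: "finite (sub n w)"
  by (simp add: sub_def)

text \<open>Two equal windows starting within one period would make the difference of their
  positions a smaller period.\<close>

lemma period_le_card_sub:
  assumes n: "0 < n" and w: "w \<in> C n"
  shows "period w \<le> card (sub n w)"
proof -
  have ne: "w \<noteq> []" and len: "length w = 2 * n"
    using w n by (auto simp: C_iff)
  have no_less: False
    if "s < t" "t < period w" "cyclic_window n w s = cyclic_window n w t" for s t
  proof -
    have eq: "cyc w (s + j) = cyc w (t + j)" for j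
      using cyclic_window_C_eq that assms by blast
    have "period w \<le> t - s"
    proof (rule period_least[OF ne])
      fix i
      have s: "s < 2 * n" using that period_le_length[OF ne] len by simp
      have "cyc w (i + (t - s)) = cyc w (i + (t - s) + length w)" by simp
      also have "i + (t - s) + length w = t + (i + (2 * n - s))" using s len that by simp
      also have "cyc w \<dots> = cyc w (s + (i + (2 * n - s)))" using eq by simp
      also have "s + (i + (2 * n - s)) = i + length w" using s len by simp
      finally show "cyc w (i + (t - s)) = cyc w i" by simp
    qed (use that in simp)
    then show False using that by simp
  qed
  have "inj_on (cyclic_window n w) {..<period w}"
    by (rule inj_onI) (metis no_less linorder_neqE_nat lessThan_iff)
  moreover have "cyclic_window n w ` {..<period w} \<subseteq> sub n w"
    using period_le_length[OF ne] by (auto simp: sub_def intro: less_le_trans)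
  ultimately show ?thesis
    using card_inj_on_le[OF _ _ finite_sub] by (metis card_lessThan)
qed

section \<open>Lexicographic successors in \<open>C n\<close>\<close>

text \<open>Lengthening the final run of zeros by one makes it strictly longer than all other runs of
  zeros, so it stays at the front of the necklace.\<close>

lemma C_extend_trailing_zeros:
  assumes n: "0 < n" and w: "w \<in> C n" and kn: "trailing_zeros w < n"
  obtains v where "v \<in> C n" "w < v" "\<And>j. j < n - trailing_zeros w - 1 \<Longrightarrow> v ! j = w ! j"
proof -
  let ?k = "trailing_zeros w"
  \<comment> \<open>Counted from 0, \<open>q\<close> is the place of the 0 just before the ones that
    end the first half; \<open>b\<close> turns it into 1, and \<open>v\<close> flips its antipode as
    well.\<close>
  define q where "q = n - ?k - 1"
  have q: "q < n" using kn by (simp add: q_def)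
  define b where "b = (take n w)[q := True]"
  define v where "v = b @ complement b"
  have len: "length w = 2 * n" and hdw: "hd w" and anti: "\<And>i. cyc w (i + n) = (\<not> cyc w i)"
    using assms by (auto simp: C_iff)
  have ne: "w \<noteq> []" using len n by auto
  have w0: "w ! 0" using hdw ne by (simp add: hd_conv_nth)
  note tz = trailing_zeros[OF w n]
  have lb: "length b = n" using len by (simp add: b_def)
  have lv: "length v = 2 * n" by (simp add: v_def lb complement_def)
  have nev: "v \<noteq> []" using lv n by auto
  have nth_anti: "w ! (i + n) = (\<not> w ! i)" if "i < n" for i
    using anti[of i] that len by (simp add: cyc_nth)
  have v_lo: "v ! j = (if j = q then True else w ! j)" if "j < n" for j
    using that lb len by (simp add: v_def nth_append b_def nth_list_update)
  have v_hi: "v ! (j + n) = (\<not> v ! j)" if "j < n" for j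
    using that lb by (simp add: v_def nth_append complement_def)
  have v_eq: "v ! j = w ! j" if "j \<noteq> q" "j < q + n" for j
  proof (cases "j < n")
    case False
    then have "j - n < n" "j - n \<noteq> q" "j = (j - n) + n" using that q by auto
    then show ?thesis using v_hi[of "j - n"] nth_anti[of "j - n"] v_lo[of "j - n"] by simp
  qed (use v_lo that in simp)
  have v0: "v ! 0" using v_lo[of 0] w0 n by simp
  then have hdv: "hd v" using nev by (simp add: hd_conv_nth)
  have anti_v: "\<forall>i. cyc v (i + n) = (\<not> cyc v i)"
    using append_complement_iff[OF lv n] lb v_def by blast
  have v_zero: "\<not> v ! j" if "q + n \<le> j" "j < 2 * n" for j
  proof -
    have "v ! (j - n)" using v_lo[of "j - n"] tz(4)[of "j - n"] that q_def kn by auto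
    then show ?thesis using v_hi[of "j - n"] that by simp
  qed
  let ?L = "last_one_index v"
  note L = last_one_index[OF nev hdv]
  have Lq: "?L \<le> q + n"
  proof (rule ccontr)
    assume "\<not> ?L \<le> q + n"
    then have "q + n \<le> ?L - 1" "?L - 1 < 2 * n" using L(1,2) lv by linarith+
    then show False using v_zero L(3) by blast
  qed
  \<comment> \<open>The number of trailing zeros of \<open>v\<close>. It can exceed
    \<open>?k + 1\<close>, since the new 0 at \<open>q + n\<close> may join an earlier run of
    zeros.\<close>
  define K where "K = 2 * n - ?L"
  have LK: "?L + K = 2 * n" "?k < K" using Lq q_def kn by (auto simp: K_def)
  \<comment> \<open>Beyond \<open>?L\<close>, a run of \<open>K\<close> zeros would reach the
    wrapped leading 1. Before \<open>?L\<close>, it would end ahead of \<open>q + n\<close>, where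
    each 1 of \<open>w\<close> survives in \<open>v\<close>; but any \<open>?k + 1\<close>
    cyclically consecutive letters of \<open>w\<close> contain a 1.\<close>
  have unique_run: "\<exists>j<K. cyc v (x + j)" if "x < 2 * n" "x \<noteq> ?L" for x
  proof (rule ccontr)
    assume "\<not> (\<exists>j<K. cyc v (x + j))"
    then have zero: "\<not> cyc v (x + j)" if "j < K" for j using that by blast
    have in_run: "\<not> v ! i" if "x \<le> i" "i < x + K" "i < 2 * n" for i
      using zero[of "i - x"] that lv by (simp add: cyc_nth)
    show False
    proof (cases "x < ?L")
      case False
      then have "2 * n - x < K" using that LK by linarith
      then show False using zero[of "2 * n - x"] that v0 lv by (simp add: cyc_def)
    next
      case True
      have "x + K \<le> ?L - 1"
        using in_run[of "?L - 1"] L True lv by (cases "x + K \<le> ?L - 1") auto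
      then have bound: "x + K < q + n" using Lq L(1) by simp
      obtain j where j: "j \<le> ?k" "cyc w (x + j)" using tz(6) by blast
      have xj: "x + j < x + K" "x + j < q + n" using j LK bound by auto
      then have "w ! (x + j)" using j len q by (simp add: cyc_nth)
      moreover have "x + j \<noteq> q" using in_run[of q] v_lo[OF q] xj q by auto
      ultimately have "v ! (x + j)" using v_eq[of "x + j"] xj by simp
      then show False using in_run[of "x + j"] xj q by simp
    qed
  qed
  have "rotate ?L v \<le> rotate t v" for t
  proof (cases "t mod (2 * n) = ?L")
    case True
    then show ?thesis using lv by (metis rotate_conv_mod order_refl)
  next
    case False
    define x where "x = t mod (2 * n)"
    have x: "x < 2 * n" "x \<noteq> ?L" using False n by (auto simp: x_def)
    have rx: "rotate t v = rotate x v" using lv by (metis rotate_conv_mod x_def)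
    \<comment> \<open>At the first 1 of the rotation by \<open>x\<close>, the rotation by
      \<open>?L\<close> still has one of its \<open>K\<close> leading zeros.\<close>
    obtain j where j: "j < K" "cyc v (x + j)" and min: "\<And>i. i < j \<Longrightarrow> \<not> cyc v (x + i)"
      using unique_run[OF x] exists_least_iff[of "\<lambda>j. j < K \<and> cyc v (x + j)"]
      by (metis less_trans)
    have jn: "j < 2 * n" using j LK by simp
    have zL: "\<not> rotate ?L v ! i" if "i < K" for i
      using L(4)[of "?L + i"] that LK lv by (simp add: nth_rotate)
    have x_nth: "rotate x v ! i = cyc v (x + i)" if "i < 2 * n" for i
      using that lv by (simp add: nth_rotate cyc_def)
    have "rotate ?L v < rotate x v"
      by (rule list_less_nthI[of _ _ j]) (use jn lv j min zL x_nth in auto)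
    then show ?thesis using rx by simp
  qed
  then have "v \<in> C n" using n lv hdv anti_v by (auto simp: C_iff)
  moreover have "w < v"
    by (rule list_less_nthI[of _ _ q])
      (use len lv q v_lo tz(5)[OF kn] in \<open>auto simp: q_def\<close>)
  moreover have "v ! j = w ! j" if "j < n - ?k - 1" for j
    using v_lo[of j] that q by (simp add: q_def)
  ultimately show ?thesis using that by blast
qed

text \<open>With \<open>n\<close> trailing zeros the first half consists of ones, so a larger string
  would first differ in the second half, which the first half determines.\<close>

lemma trailing_zeros_less_if_not_greatest:
  assumes n: "0 < n" and w: "w \<in> C n" and v: "v \<in> C n" and "w < v"
  shows "trailing_zeros w < n"
proof (rule ccontr)
  assume "\<not> trailing_zeros w < n"
  then have one: "w ! j" if "j < n" for j using trailing_zeros(4)[OF w n, of j] that by simp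
  have len: "length w = 2 * n" "length v = 2 * n"
    and anti: "\<And>i. cyc w (i + n) = (\<not> cyc w i)" "\<And>i. cyc v (i + n) = (\<not> cyc v i)"
    using assms by (auto simp: C_iff)
  obtain j where j: "j < length w" "\<And>i. i < j \<Longrightarrow> w ! i = v ! i" "w ! j < v ! j"
    using list_less_nthE[of w v] len \<open>w < v\<close> by auto
  have "n \<le> j" using one[of j] j by (cases "n \<le> j") auto
  then have "w ! (j - n) = v ! (j - n)" using j n by simp
  then show False using anti[of "j - n"] j len \<open>n \<le> j\<close> by (simp add: cyc_nth)
qed

text \<open>The successor is squeezed between \<open>w\<close> and the string from
  \<open>C_extend_trailing_zeros\<close>, which share these letters.\<close>

lemma next_in_C_common_prefix:
  assumes n: "0 < n" and w: "w \<in> C n" and v: "v \<in> C n" and "w < v"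
    and succ: "\<And>x. x \<in> C n \<Longrightarrow> w < x \<Longrightarrow> v \<le> x" and j: "j < n - trailing_zeros w - 1"
  shows "v ! j = w ! j"
proof -
  have "trailing_zeros w < n" using trailing_zeros_less_if_not_greatest assms by blast
  then obtain x where x: "x \<in> C n" "w < x" "\<And>j. j < n - trailing_zeros w - 1 \<Longrightarrow> x ! j = w ! j"
    using C_extend_trailing_zeros[OF n w] by metis
  have "length w = 2 * n" "length v = 2 * n" "length x = 2 * n"
    using w v x n by (auto simp: C_iff)
  then show ?thesis
    using list_squeeze_nth[of w v x "n - trailing_zeros w - 1" j] x succ[OF x(1,2)] \<open>w < v\<close> j
    by simp
qed

text \<open>Otherwise the extension would be larger. This gives the backward induction along the
  list its starting point.\<close>

lemma trailing_zeros_greatest: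
  assumes n: "0 < n" and w: "w \<in> C n" and "\<And>x. x \<in> C n \<Longrightarrow> x \<le> w"
  shows "trailing_zeros w = n"
proof (rule ccontr)
  assume "trailing_zeros w \<noteq> n"
  then have "trailing_zeros w < n" using trailing_zeros(1)[OF w n] by simp
  then show False using C_extend_trailing_zeros[OF n w] assms(3) by (metis leD)
qed

subsection \<open>Covering all windows\<close>

text \<open>Being the last entries of the sorted \<open>C n\<close> is expressed locally: neighbours
  in the list are neighbours in \<open>C n\<close>, and the last entry is the maximum.\<close>

locale final_segment =
  fixes n :: nat and ws :: "bool list list"
  assumes n_pos: "0 < n" and ws_ne: "ws \<noteq> []" and ws_C: "set ws \<subseteq> C n"
    and ws_less: "Suc i < length ws \<Longrightarrow> ws ! i < ws ! Suc i"
    and ws_succ: "Suc i < length ws \<Longrightarrow> x \<in> C n \<Longrightarrow> ws ! i < x \<Longrightarrow> ws ! Suc i \<le> x"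
    and ws_last: "x \<in> C n \<Longrightarrow> x \<le> ws ! (length ws - 1)"
begin

abbreviation "u \<equiv> UC ws"
abbreviation "p i \<equiv> period (ws ! i)"
abbreviation "k i \<equiv> trailing_zeros (ws ! i)"

definition off :: "nat \<Rightarrow> nat" where
  "off i = length (UC (take i ws))"

lemma nth_C: "i < length ws \<Longrightarrow> ws ! i \<in> C n"
  using ws_C by auto

lemma nth_ne: "i < length ws \<Longrightarrow> ws ! i \<noteq> []"
  using nth_C[of i] n_pos by (auto simp: C_iff)

lemma len_nth: "i < length ws \<Longrightarrow> length (ws ! i) = 2 * n"
  using nth_C n_pos by (simp add: C_iff)

lemma off_Suc: "i < length ws \<Longrightarrow> off (Suc i) = off i + p i"
  by (simp add: off_def UC_def take_Suc_conv_app_nth length_pr nth_ne)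

lemma off_0: "off 0 = 0"
  by (simp add: off_def UC_def)

lemma off_length: "off (length ws) = length u"
  by (simp add: off_def)

lemma off_Suc_le: "i < length ws \<Longrightarrow> off (Suc i) \<le> length u"
proof -
  assume "i < length ws"
  have "u = UC (take (Suc i) ws) @ UC (drop (Suc i) ws)"
    by (metis UC_def append_take_drop_id concat_append map_append)
  then show ?thesis by (metis off_def length_append le_add1)
qed

lemma cyc_UC_pr:
  assumes "i < length ws" "j < p i"
  shows "cyc u (off i + j) = cyc (ws ! i) j"
proof -
  have "u = UC (take i ws) @ pr (ws ! i) @ UC (drop (Suc i) ws)"
    using id_take_nth_drop[OF assms(1)]
    by (metis UC_def append_Cons append_Nil concat.simps(2) concat_append list.simps(9) map_append)
  then have "u ! (off i + j) = pr (ws ! i) ! j"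
    using assms by (simp add: off_def nth_append length_pr nth_ne)
  moreover have "off i + j < length u"
    using off_Suc off_Suc_le assms by fastforce
  moreover have "j < length (ws ! i)"
    using period_le_length[OF nth_ne] assms by fastforce
  ultimately show ?thesis using assms by (simp add: cyc_nth pr_eq_take)
qed

lemma next_common_prefix:
  assumes "Suc i < length ws" "j < n - k i - 1"
  shows "ws ! Suc i ! j = ws ! i ! j"
proof (rule next_in_C_common_prefix[OF n_pos])
  show "ws ! i \<in> C n" "ws ! Suc i \<in> C n" using assms(1) by (simp_all add: nth_C)
qed (use assms ws_less ws_succ in blast)+

lemma k_last: "k (length ws - 1) = n"
  by (rule trailing_zeros_greatest[OF n_pos]) (use ws_last nth_C ws_ne in simp_all)

lemma k_less_p: "i < length ws \<Longrightarrow> k i < p i"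
  using trailing_zeros(7)[OF nth_C n_pos] .

lemma k_le: "i < length ws \<Longrightarrow> k i \<le> n"
  using trailing_zeros(1)[OF nth_C n_pos] .

text \<open>Induction from the last string backwards. Beyond its own block, a string continues
  periodically with its own prefix, and the next string shares \<open>n - k i - 1\<close> letters of
  it.\<close>

lemma cyc_UC:
  assumes "i < length ws" "j < p i + n - k i - 1"
  shows "cyc u (off i + j) = cyc (ws ! i) j"
  using assms
proof (induction "length ws - i" arbitrary: i j rule: less_induct)
  case less
  show ?case
  proof (cases "j < p i")
    case True
    then show ?thesis by (rule cyc_UC_pr[OF less.prems(1)])
  next
    case False
    then have "k i < n" using less.prems by simp
    \<comment> \<open>The last string has \<open>n\<close> trailing zeros, so its range stays within
      its block; here a next string exists.\<close>
    then have "i \<noteq> length ws - 1" using k_last by auto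
    then have i: "Suc i < length ws" using less.prems by simp
    define l where "l = j - p i"
    have j: "j = l + p i" and l: "l < n - k i - 1" using False less.prems by (auto simp: l_def)
    have "cyc u (off i + j) = cyc u (off (Suc i) + l)"
      using j less.prems by (simp add: off_Suc ac_simps)
    also have "\<dots> = cyc (ws ! Suc i) l"
      using less.hyps[of "Suc i" l] i l k_less_p[OF i] by simp
    also have "\<dots> = cyc (ws ! i) l"
      using next_common_prefix[OF i l] l len_nth i less.prems by (simp add: cyc_nth)
    also have "\<dots> = cyc (ws ! i) j"
      unfolding j by (rule cyc_add_period[symmetric]) (simp add: nth_ne less.prems)
    finally show ?thesis .
  qed
qed

lemma cyc_UC_prefix:
  assumes "i < length ws" "j < n"
  shows "cyc u (off i + j) = ws ! i ! j"
proof -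
  have "j < p i + n - k i - 1" using k_less_p[OF assms(1)] assms(2) by linarith
  then show ?thesis using cyc_UC[OF assms(1)] len_nth[OF assms(1)] assms(2) by (simp add: cyc_nth)
qed

text \<open>As the period divides \<open>2 * n\<close>, the last \<open>k i\<close> letters of the
  first period are copies of the final zeros of the whole string.\<close>

lemma cyc_trailing:
  assumes i: "i < length ws" and "p i - k i \<le> j" "j < p i"
  shows "\<not> cyc (ws ! i) j"
proof -
  have le: "p i \<le> 2 * n" using period_le_length[OF nth_ne[OF i]] len_nth[OF i] by simp
  obtain c where "2 * n = p i * c"
    using period_dvd[OF nth_ne[OF i]] len_nth[OF i] by auto
  moreover from this have "c \<noteq> 0" using n_pos by (metis mult_0_right mult_eq_0_iff not_gr_zero zero_neq_numeral)
  ultimately have "j + (2 * n - p i) = j + (c - 1) * p i" by (cases c) auto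
  then have "cyc (ws ! i) j = cyc (ws ! i) (j + (2 * n - p i))"
    using periodic_add_mult[of "cyc (ws ! i)" "p i" j "c - 1"] cyc_add_period[OF nth_ne[OF i]]
    by simp
  also have "\<dots> = ws ! i ! (j + (2 * n - p i))"
    using assms le len_nth[OF i] by (simp add: cyc_nth)
  finally show ?thesis
    using trailing_zeros(3)[OF nth_C[OF i] n_pos, of "j + (2 * n - p i)"] assms le k_less_p[OF i]
    by simp
qed

text \<open>Below, \<open>h\<close> is the first string that shares the prefix of length \<open>n - r\<close>: by minimality its
  cyclic predecessor \<open>l\<close> has at least \<open>r\<close> trailing zeros.\<close>

lemma window_in_trailing_zeros:
  assumes i: "i < length ws" and r: "0 < r" "r \<le> k i"
  shows "\<exists>x<length u. cyclic_window n u x = cyclic_window n (ws ! i) (p i - r)"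
proof -
  have rn: "r \<le> n" using r k_le[OF i] by simp
  let ?P = "\<lambda>h. h < length ws \<and> (\<forall>j<n - r. ws ! h ! j = ws ! i ! j)"
  define h where "h = (LEAST h. ?P h)"
  have h: "?P h" unfolding h_def by (rule LeastI[of ?P i]) (use i in simp)
  have h_min: "\<not> ?P h'" if "h' < h" for h' using that not_less_Least unfolding h_def by blast
  obtain l where l: "l < length ws" "r \<le> k l"
    and wrap: "\<And>y. cyc u (off (Suc l) + y) = cyc u (off h + y)"
  proof (cases h)
    \<comment> \<open>Cyclically, the first block follows the last one, whose string has
      \<open>n\<close> trailing zeros.\<close>
    case 0
    have "cyc u (length u + y) = cyc u y" for y by (metis add.commute cyc_add_length)
    then show ?thesis using that[of "length ws - 1"] k_last rn ws_ne 0 by (simp add: off_length off_0)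
  next
    case (Suc l)
    then have l: "l < length ws" "Suc l < length ws" using h by auto
    \<comment> \<open>String \<open>l\<close> differs from its successor within the first
      \<open>n - r\<close> letters, while they agree on the first
      \<open>n - k l - 1\<close>.\<close>
    have "\<not> ?P l" using h_min Suc by blast
    then obtain j where "j < n - r" "ws ! l ! j \<noteq> ws ! Suc l ! j" using h Suc l by auto
    then have "\<not> j < n - k l - 1" using next_common_prefix[OF l(2), of j] by auto
    with \<open>j < n - r\<close> have "r \<le> k l" by simp
    then show ?thesis using that[of l] l Suc by simp
  qed
  \<comment> \<open>The window at \<open>x\<close> reads the last \<open>r\<close> zeros of block
    \<open>l\<close>, then the first \<open>n - r\<close> letters of string
    \<open>h\<close>.\<close>
  define x where "x = off (Suc l) - r"
  have x: "x + r = off (Suc l)" "x = off l + (p l - r)"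
    using off_Suc[OF l(1)] l k_less_p[OF l(1)] by (auto simp: x_def)
  then have "x < length u" using off_Suc_le[OF l(1)] r by simp
  have rp: "r < p i" using r k_less_p[OF i] by simp
  have "cyc u (x + j) = cyc (ws ! i) (p i - r + j)" if j: "j < n" for j
  proof (cases "j < r")
    case True
    have "cyc u (x + j) = cyc (ws ! l) (p l - r + j)"
      using cyc_UC_pr[OF l(1), of "p l - r + j"] True x l k_less_p[OF l(1)] by (simp add: ac_simps)
    also have "\<dots> = False"
      using cyc_trailing[OF l(1), of "p l - r + j"] True l k_less_p[OF l(1)] by simp
    also have "False = cyc (ws ! i) (p i - r + j)"
      using cyc_trailing[OF i, of "p i - r + j"] True r rp by simp
    finally show ?thesis .
  next
    case False
    define y where "y = j - r"
    have y: "j = r + y" "y < n - r" using False j by (auto simp: y_def)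
    have "cyc u (x + j) = cyc u (off h + y)"
      using wrap[of y] x(1) y by (simp add: add.assoc[symmetric])
    also have "\<dots> = ws ! i ! y" using cyc_UC_prefix[of h y] h y by simp
    also have "\<dots> = cyc (ws ! i) y" using y len_nth[OF i] by (simp add: cyc_nth)
    also have "\<dots> = cyc (ws ! i) (y + p i)" using cyc_add_period[OF nth_ne[OF i]] by simp
    also have "y + p i = p i - r + j" using y rp by simp
    finally show ?thesis .
  qed
  then show ?thesis using \<open>x < length u\<close> by (auto simp: cyclic_window_eq_iff)
qed

lemma window_in_UC:
  assumes i: "i < length ws"
  shows "\<exists>x<length u. cyclic_window n u x = cyclic_window n (ws ! i) t"
proof -
  note per = cyc_add_period[OF nth_ne[OF i]]
  define s where "s = t mod p i"
  have s: "s < p i" using period_pos[OF nth_ne[OF i]] by (simp add: s_def)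
  have ts: "cyclic_window n (ws ! i) t = cyclic_window n (ws ! i) s"
    unfolding cyclic_window_eq_iff
    using periodic_mod[of "cyc (ws ! i)" "p i", OF per] by (metis mod_add_left_eq s_def)
  show ?thesis
  proof (cases "s < p i - k i")
    case True
    \<comment> \<open>The window ends at \<open>s + n - 1\<close>, which is in the range of
      \<open>cyc_UC\<close> because \<open>s\<close> lies before the trailing zeros.\<close>
    have "cyclic_window n u (off i + s) = cyclic_window n (ws ! i) s"
      using cyc_UC[OF i, of "s + _"] True by (simp add: cyclic_window_eq_iff add.assoc)
    moreover have "off i + s < length u" using off_Suc_le[OF i] off_Suc[OF i] s by simp
    ultimately show ?thesis using ts by auto
  next
    case False
    then show ?thesis
      using window_in_trailing_zeros[OF i, of "p i - s"] s ts by simp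
  qed
qed

section \<open>Counting windows\<close>

lemma distinct_ws: "distinct ws"
proof -
  have "sorted_wrt (<) ws"
    using ws_less by (simp add: sorted_wrt_iff_nth_Suc_transp)
  then show ?thesis by (simp add: strict_sorted_iff)
qed

text \<open>The window sets are disjoint, so the bounds for the single strings add up.\<close>

lemma length_UC_le: "length u \<le> card (\<Union>w\<in>set ws. sub n w)"
proof -
  have "length u = (\<Sum>w\<leftarrow>ws. length (pr w))"
    by (simp add: UC_def length_concat comp_def)
  also have "\<dots> = (\<Sum>w\<in>set ws. length (pr w))"
    by (rule sum_list_distinct_conv_sum_set[OF distinct_ws])
  also have "\<dots> \<le> (\<Sum>w\<in>set ws. card (sub n w))"
  proof (rule sum_mono)
    fix w assume "w \<in> set ws"
    then have "w \<in> C n" "w \<noteq> []" using ws_C nth_ne by (blast, metis in_set_conv_nth)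
    then show "length (pr w) \<le> card (sub n w)"
      using period_le_card_sub[OF n_pos] by (simp add: length_pr)
  qed
  also have "\<dots> = card (\<Union>w\<in>set ws. sub n w)"
    by (rule card_UN_disjoint[symmetric])
      (use ws_C sub_disjoint[OF n_pos] finite_sub in \<open>auto simp: subset_iff\<close>)
  finally show ?thesis .
qed

text \<open>Every window occurs and there are at least as many windows as positions, so each occurs
  exactly once.\<close>

lemma universal_cycle_UC: "universal_cycle n (\<Union>w\<in>set ws. sub n w) u"
proof -
  let ?S = "\<Union>w\<in>set ws. sub n w" and ?f = "cyclic_window n u"
  have cover: "?S \<subseteq> ?f ` {..<length u}"
  proof
    fix s assume "s \<in> ?S"
    then obtain i t where "i < length ws" "s = cyclic_window n (ws ! i) t"
      by (auto simp: in_set_conv_nth sub_def)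
    then show "s \<in> ?f ` {..<length u}" using window_in_UC[of i t] by force
  qed
  have "card (?f ` {..<length u}) \<le> length u"
    using card_image_le[of "{..<length u}" ?f] by simp
  moreover have "card ?S \<le> card (?f ` {..<length u})"
    using cover by (intro card_mono) auto
  ultimately have card: "card ?S = length u" "card (?f ` {..<length u}) = length u"
    using length_UC_le by auto
  then have "inj_on ?f {..<length u}" by (intro eq_card_imp_inj_on) auto
  then have "\<forall>s\<in>?S. \<exists>!i. i < length u \<and> ?f i = s"
    using cover by (simp add: inj_on_def subset_iff image_iff) blast
  moreover have "?S \<noteq> {}"
  proof -
    have "cyclic_window n (ws ! 0) 0 \<in> sub n (ws ! 0)"
      using nth_ne[of 0] ws_ne by (auto simp: sub_def)
    then show ?thesis using ws_ne nth_mem[of 0 ws] by auto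
  qed
  moreover have "?S \<subseteq> \<Sigma>2 n" by (auto simp: sub_def \<Sigma>2_def cyclic_window_def)
  ultimately show ?thesis using card(1) by (simp add: universal_cycle_def)
qed

end

theorem theorem6:
  fixes n m :: nat and \<alpha>s :: "bool list list"
  assumes "n \<ge> 2" and "1 \<le> m" and "m \<le> card (C n)"
    and "\<alpha>s = drop (card (C n) - m) (sorted_list_of_set (C n))"
  shows "universal_cycle n (\<Union>\<alpha>\<in>set \<alpha>s. sub n \<alpha>) (UC \<alpha>s)"
proof -
  let ?l = "sorted_list_of_set (C n)"
  define d where "d = card (C n) - m"
  \<comment> \<open>An infinite set has \<open>card\<close> 0, so the bounds on \<open>m\<close>
    force finiteness.\<close>
  have fin: "finite (C n)" using assms by (metis card.infinite le_0_eq not_one_le_zero)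
  have len: "length ?l = card (C n)" by simp
  have len\<alpha>: "length \<alpha>s = m" using assms by simp
  have nth: "\<alpha>s ! i = ?l ! (d + i)" if "i < m" for i
    using that assms by (simp add: d_def)
  have less: "?l ! i < ?l ! j" if "i < j" "j < card (C n)" for i j
    using sorted_wrt_nth_less[OF strict_sorted_list_of_set] that by simp
  have le: "?l ! i \<le> ?l ! j" if "i \<le> j" "j < card (C n)" for i j
    using less[of i j] that by (cases "i = j") auto
  have mem: "\<exists>j<card (C n). x = ?l ! j" if "x \<in> C n" for x
    using that fin len by (metis in_set_conv_nth set_sorted_list_of_set)
  interpret final_segment n \<alpha>s
  proof
    show "0 < n" using assms by simp
    show "\<alpha>s \<noteq> []" using len\<alpha> assms by auto
    show "set \<alpha>s \<subseteq> C n" using set_drop_subset[of _ ?l] fin assms(4) by auto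
  next
    fix i assume "Suc i < length \<alpha>s"
    then show "\<alpha>s ! i < \<alpha>s ! Suc i" using nth less len\<alpha> assms by (simp add: d_def)
  next
    fix i x assume i: "Suc i < length \<alpha>s" and x: "x \<in> C n" "\<alpha>s ! i < x"
    obtain j where j: "j < card (C n)" "x = ?l ! j" using mem x by blast
    have "d + i < card (C n)" using i len\<alpha> assms(3) by (simp add: d_def)
    moreover have "\<not> x \<le> ?l ! (d + i)" using x nth[of i] i len\<alpha> by simp
    ultimately have "\<not> j \<le> d + i" using le j by blast
    then show "\<alpha>s ! Suc i \<le> x" using le[of "d + Suc i" j] j nth[of "Suc i"] i len\<alpha> by simp
  next
    fix x assume "x \<in> C n"
    then obtain j where "j < card (C n)" "x = ?l ! j" using mem by blast
    then show "x \<le> \<alpha>s ! (length \<alpha>s - 1)"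
      using le[of j "d + (m - 1)"] nth[of "m - 1"] len\<alpha> assms by (simp add: d_def)
  qed
  show ?thesis by (rule universal_cycle_UC)
qed

end
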